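(* For each integer $k \geq 0$, let $S_k(x)$ be the unique polynomial in $x$ such that $S_k(n) = 1^k + 2^k + \cdots + n^k$ for every positive integer $n$. Then for all integers $k \geq 0$ and $n \geq 1$, $$S_{k}(-n) = \frac{(-1)^{k+1}}{k+1} \sum_{j=1}^{k+1} (-1)^{j}\, j!\, \left\{ {k+1 \atop j} \right\} \sum_{i=1}^{j} \frac{(-1)^i}{j+1-i} \binom{n}{i}.$$
   Context: $\left\{ {k \atop j} \right\}$ denotes the Stirling number of the second kind (the number of partitions of a $k$-element set into $j$ nonempty blocks). $\binom{n}{i}$ is the usual binomial coefficient, equal to $0$ when $i > n$. *)

theory Defs
  imports
    Complex_Main
    "HOL-Computational_Algebra.Polynomial"
    "HOL-Combinatorics.Stirling"
begin

definition power_sum_poly :: "nat \<Rightarrow> real poly" where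
  "power_sum_poly k =
     (THE p. \<forall>n\<ge>1. poly p (real n) = (\<Sum>m=1..n. real m ^ k))"

end

theory Submission
  imports Defs
begin

text \<open>
  Everything rests on the relation \<open>S\<^sub>k(x + 1) - S\<^sub>k(x) = (x + 1)\<^sup>k\<close>, which, being an identity of
  polynomials, can also be followed from \<open>S\<^sub>k(0) = 0\<close> down to the negative integers.  It gives
  \<open>S\<^sub>k(-n) = (-1)\<^sup>k\<^sup>+\<^sup>1 (0\<^sup>k + 1\<^sup>k + \<dots> + (n - 1)\<^sup>k)\<close> with \<open>0\<^sup>0 = 1\<close>.  It therefore suffices that the
  double sum \<open>F(n)\<close> on the right, which vanishes at \<open>0\<close>, satisfies \<open>F(n + 1) - F(n) = (k + 1) n\<^sup>k\<close>.

  The number \<open>(k + 1) n\<^sup>k\<close> is the derivative of \<open>x\<^sup>k\<^sup>+\<^sup>1\<close> at \<open>n\<close>, and expanding the power into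
  binomials (\<open>power_eq_sum_Stirling_gbinomial\<close>) turns it into a combination of derivatives of
  \<open>x gchoose j\<close>.  The formal identity \<open>d/dx = log (1 + \<Delta>) = \<Delta> - \<Delta>\<^sup>2/2 + \<Delta>\<^sup>3/3 - \<dots>\<close>, where
  \<open>\<Delta>\<close> is the forward difference, together with \<open>\<Delta>\<^sup>m (x gchoose j) = x gchoose (j - m)\<close>, evaluates
  these derivatives (\<open>gbinomial_has_derivative_at_nat\<close>).  Up to the sign \<open>(-1)\<^sup>j\<close>, the result is the
  forward difference of the inner sum on the right (\<open>inner_sum_Suc\<close>).
\<close>

section \<open>Powers as combinations of binomials\<close>

text \<open>The recurrence of the Stirling numbers mirrors
  \<open>x \<cdot> (x gchoose j) = j \<cdot> (x gchoose j) + (j + 1) \<cdot> (x gchoose (j + 1))\<close>.\<close>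

lemma power_eq_sum_Stirling_gbinomial:
  fixes x :: "'a::field_char_0"
  shows "x ^ k = (\<Sum>j\<le>k. of_nat (Stirling k j) * fact j * (x gchoose j))"
proof (induction k)
  case 0
  then show ?case by simp
next
  case (Suc k)
  define a where "a j = of_nat (Stirling k j) * fact j * (x gchoose j)" for j
  have "x ^ Suc k = (\<Sum>j\<le>k. of_nat (Stirling k j) * fact j * (x * (x gchoose j)))"
    by (simp add: Suc.IH sum_distrib_left mult_ac)
  also have "\<dots> = (\<Sum>j\<le>k. of_nat j * a j)
      + (\<Sum>j\<le>k. of_nat (Stirling k j) * fact (Suc j) * (x gchoose Suc j))"
    by (simp only: gbinomial_mult_1 a_def) (simp add: algebra_simps sum.distrib)
  also have "(\<Sum>j\<le>k. of_nat j * a j) = (\<Sum>j\<le>Suc k. of_nat j * a j)"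
    by (simp add: a_def)
  also have "\<dots> = (\<Sum>j\<le>k. of_nat (Suc j) * a (Suc j))"
    by (subst sum.atMost_Suc_shift) simp
  also have "\<dots> + (\<Sum>j\<le>k. of_nat (Stirling k j) * fact (Suc j) * (x gchoose Suc j))
      = (\<Sum>j\<le>k. of_nat (Stirling (Suc k) (Suc j)) * fact (Suc j) * (x gchoose Suc j))"
    unfolding sum.distrib [symmetric]
    by (intro sum.cong) (simp_all add: a_def algebra_simps)
  also have "\<dots> = (\<Sum>j\<le>Suc k. of_nat (Stirling (Suc k) j) * fact j * (x gchoose j))"
    by (subst sum.atMost_Suc_shift) simp
  finally show ?case .
qed

section \<open>The power sum polynomial at negative integers\<close>

lemma gbinomial_poly_exists:
  "\<exists>p :: 'a::field_char_0 poly. \<forall>x. poly p x = x gchoose j"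
  by (intro exI [of _ "smult (1 / fact j) (\<Prod>i=0..<j. [:- of_nat i, 1:])"])
     (simp add: poly_prod gbinomial_prod_rev field_simps)

text \<open>By Pascal's rule \<open>(x + 1) gchoose (j + 1)\<close> has the backward difference \<open>x gchoose j\<close>, so
  summing the binomial expansion of a power term by term gives the power sum.\<close>

lemma power_sum_poly_recurrence_exists:
  "\<exists>p :: real poly. poly p 0 = 0 \<and> (\<forall>x. poly p (x + 1) - poly p x = (x + 1) ^ k)"
proof -
  obtain b :: "nat \<Rightarrow> real poly" where b: "\<And>j x. poly (b j) x = x gchoose j"
    using gbinomial_poly_exists by metis
  define q where "q = (\<Sum>j\<le>k. smult (real (Stirling k j) * fact j) (b (Suc j) \<circ>\<^sub>p [:1, 1:]))"
  have q: "poly q x = (\<Sum>j\<le>k. real (Stirling k j) * fact j * ((x + 1) gchoose Suc j))" for x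
    by (simp add: q_def poly_sum poly_pcompose b add.commute)
  have "poly q (x + 1) - poly q x = (x + 1) ^ k" for x
    unfolding q power_eq_sum_Stirling_gbinomial [of "x + 1" k] gbinomial_Suc_Suc [of "x + 1"]
    by (simp add: sum_subtractf [symmetric] algebra_simps)
  then show ?thesis
    by (intro exI [of _ "q - [:poly q 0:]"]) simp
qed

lemma power_sum_poly_recurrence:
  "poly (power_sum_poly k) 0 = 0"
  "poly (power_sum_poly k) (x + 1) - poly (power_sum_poly k) x = (x + 1) ^ k"
proof -
  obtain p :: "real poly" where p0: "poly p 0 = 0"
    and p: "\<And>x. poly p (x + 1) - poly p x = (x + 1) ^ k"
    using power_sum_poly_recurrence_exists by metis
  have sums: "poly p (real n) = (\<Sum>m=1..n. real m ^ k)" for n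
  proof (induction n)
    case 0
    then show ?case by (simp add: p0)
  next
    case (Suc n)
    then show ?case using p [of "real n"] by (simp add: add.commute)
  qed
  have "power_sum_poly k = p"
    unfolding power_sum_poly_def
  proof (rule the_equality)
    fix q :: "real poly"
    assume q: "\<forall>n\<ge>1. poly q (real n) = (\<Sum>m=1..n. real m ^ k)"
    have "infinite (real ` {1..})"
      by (simp add: finite_image_iff inj_on_def infinite_Ici)
    moreover have "real ` {1..} \<subseteq> {x. poly (q - p) x = 0}"
      using q sums by auto
    ultimately have "q - p = 0"
      using poly_roots_finite finite_subset by blast
    then show "q = p" by simp
  qed (simp add: sums)
  then show "poly (power_sum_poly k) 0 = 0"
    "poly (power_sum_poly k) (x + 1) - poly (power_sum_poly k) x = (x + 1) ^ k"
    using p0 p by simp_all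
qed

lemma power_sum_poly_uminus:
  "poly (power_sum_poly k) (- real n) = (- 1) ^ (k + 1) * (\<Sum>m<n. real m ^ k)"
proof (induction n)
  case 0
  then show ?case by (simp add: power_sum_poly_recurrence)
next
  case (Suc n)
  have "poly (power_sum_poly k) (- real (Suc n))
      = poly (power_sum_poly k) (- real n) - (- real n) ^ k"
    using power_sum_poly_recurrence(2) [of k "- real (Suc n)"] by simp
  then show ?case
    by (simp add: Suc.IH power_minus [of "real n"] algebra_simps)
qed

section \<open>Derivatives of binomials\<close>

text \<open>The derivative of \<open>x gchoose j\<close> at a natural number \<open>n\<close>, as the operator
  \<open>log (1 + \<Delta>)\<close> gives it.  The exponent \<open>i + j + 1\<close> has the parity of \<open>j - i - 1\<close>.\<close>

definition gbinomial_deriv :: "nat \<Rightarrow> nat \<Rightarrow> real" where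
  "gbinomial_deriv j n = (\<Sum>i<j. (- 1) ^ (i + j + 1) / real (j - i) * real (n choose i))"

lemma gbinomial_deriv_at_0:
  "gbinomial_deriv j 0 = (if j = 0 then 0 else (- 1) ^ (j + 1) / real j)"
proof (cases j)
  case (Suc j')
  then show ?thesis
    unfolding gbinomial_deriv_def by (subst Suc, subst sum.lessThan_Suc_shift) simp
qed (simp add: gbinomial_deriv_def)

lemma gbinomial_deriv_Suc_Suc:
  "gbinomial_deriv (Suc j) (Suc n) = gbinomial_deriv (Suc j) n + gbinomial_deriv j n"
  unfolding gbinomial_deriv_def sum.lessThan_Suc_shift
  by (simp add: sum.distrib sum_subtractf sum_negf algebra_simps add_divide_distrib)

lemma gbinomial_has_derivative_at_0:
  "((\<lambda>x::real. x gchoose j) has_real_derivative gbinomial_deriv j 0) (at 0)"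
proof (induction j)
  case 0
  then show ?case by (simp add: gbinomial_deriv_at_0)
next
  case (Suc j)
  have eq: "(\<lambda>x::real. x gchoose Suc j) = (\<lambda>x. (x - real j) / real (Suc j) * (x gchoose j))"
  proof
    fix x :: real
    show "x gchoose Suc j = (x - real j) / real (Suc j) * (x gchoose j)"
      using gbinomial_mult_1 [of x j] by (simp add: field_simps)
  qed
  have "((\<lambda>x::real. (x - real j) / real (Suc j) * (x gchoose j)) has_real_derivative
      1 / real (Suc j) * (0 gchoose j) + gbinomial_deriv j 0 * ((0 - real j) / real (Suc j)))
      (at 0)"
    by (rule DERIV_mult [OF _ Suc.IH]) (auto intro!: derivative_eq_intros)
  moreover have "1 / real (Suc j) * (0 gchoose j) +
      gbinomial_deriv j 0 * ((0 - real j) / real (Suc j)) = gbinomial_deriv (Suc j) 0"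
    by (simp add: gbinomial_deriv_at_0 gbinomial_0_left)
  ultimately show ?case
    unfolding eq by simp
qed

text \<open>Pascal's rule carries the derivatives from \<open>n\<close> to \<open>n + 1\<close> for all \<open>j\<close> at once.\<close>

lemma gbinomial_has_derivative_at_nat:
  "((\<lambda>x::real. x gchoose j) has_real_derivative gbinomial_deriv j n) (at (real n))"
proof (induction n arbitrary: j)
  case 0
  then show ?case using gbinomial_has_derivative_at_0 by simp
next
  case (Suc n)
  show ?case
  proof (cases j)
    case 0
    then show ?thesis by (simp add: gbinomial_deriv_def)
  next
    case (Suc j')
    have "((\<lambda>x::real. (x + 1) gchoose Suc j') has_real_derivative
        gbinomial_deriv (Suc j') (Suc n)) (at (real n))"
      unfolding gbinomial_Suc_Suc gbinomial_deriv_Suc_Suc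
        add.commute [of "gbinomial_deriv (Suc j') n"]
      by (intro DERIV_add Suc.IH)
    then have "((\<lambda>x::real. x gchoose Suc j') has_real_derivative
        gbinomial_deriv (Suc j') (Suc n)) (at (real n + 1))"
      by (simp only: DERIV_shift)
    then show ?thesis
      by (simp add: Suc add.commute)
  qed
qed

text \<open>Both sides are the derivative of \<open>x ^ (k + 1)\<close> at \<open>n\<close>.\<close>

lemma Suc_times_power_eq_sum_gbinomial_deriv:
  "real (k + 1) * real n ^ k
    = (\<Sum>j=1..k + 1. real (Stirling (k + 1) j) * fact j * gbinomial_deriv j n)"
proof -
  have "((\<lambda>x::real. x ^ (k + 1)) has_real_derivative real (k + 1) * real n ^ k) (at (real n))"
    using DERIV_pow [of "k + 1" "real n"] by simp
  moreover have "((\<lambda>x::real. x ^ (k + 1)) has_real_derivative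
      (\<Sum>j\<le>k + 1. real (Stirling (k + 1) j) * fact j * gbinomial_deriv j n)) (at (real n))"
    unfolding power_eq_sum_Stirling_gbinomial
    by (intro DERIV_sum DERIV_cmult gbinomial_has_derivative_at_nat)
  ultimately have "real (k + 1) * real n ^ k
      = (\<Sum>j\<le>k + 1. real (Stirling (k + 1) j) * fact j * gbinomial_deriv j n)"
    by (rule DERIV_unique)
  also have "\<dots> = (\<Sum>j=1..k + 1. real (Stirling (k + 1) j) * fact j * gbinomial_deriv j n)"
    by (rule sum.mono_neutral_right) (auto simp: gbinomial_deriv_def not_le)
  finally show ?thesis .
qed

section \<open>Summation over the argument\<close>

text \<open>Passing to the forward difference in \<open>n\<close> lowers \<open>n choose i\<close> to \<open>n choose (i - 1)\<close>, and
  the weight \<open>1 / (j + 1 - i)\<close> is the coefficient of \<open>\<Delta>\<^bsup>j + 1 - i\<^esup>\<close> in \<open>log (1 + \<Delta>)\<close> up to sign.\<close>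

lemma inner_sum_Suc:
  "(- 1) ^ j * (\<Sum>i=1..j. (- 1) ^ i / real (j + 1 - i) * real (Suc n choose i))
    = (- 1) ^ j * (\<Sum>i=1..j. (- 1) ^ i / real (j + 1 - i) * real (n choose i))
      + gbinomial_deriv j n"
proof -
  have shift: "(\<Sum>i=1..j. f i) = (\<Sum>i<j. f (Suc i))" for f :: "nat \<Rightarrow> real"
    by (simp add: sum.atLeast1_atMost_eq)
  show ?thesis
    unfolding shift gbinomial_deriv_def sum_distrib_left sum.distrib [symmetric]
    by (intro sum.cong) (simp_all add: algebra_simps power_add add_divide_distrib diff_divide_distrib)
qed

lemma sum_powers_eq_Stirling_double_sum:
  "real (k + 1) * (\<Sum>m<n. real m ^ k) =
    (\<Sum>j = 1..k + 1. (- 1) ^ j * fact j * real (Stirling (k + 1) j) *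
      (\<Sum>i = 1..j. (- 1) ^ i / real (j + 1 - i) * real (n choose i)))"
proof -
  define T where
    "T n j = (- 1) ^ j * (\<Sum>i=1..j. (- 1) ^ i / real (j + 1 - i) * real (n choose i))" for n j
  have T_Suc: "T (Suc n) j = T n j + gbinomial_deriv j n" for n j
    unfolding T_def by (rule inner_sum_Suc)
  have T_0: "T 0 j = 0" for j
    unfolding T_def by (subst sum.neutral) (auto simp: binomial_eq_0)
  have "real (k + 1) * (\<Sum>m<n. real m ^ k)
      = (\<Sum>j = 1..k + 1. real (Stirling (k + 1) j) * fact j * T n j)"
  proof (induction n)
    case 0
    then show ?case by (simp add: T_0)
  next
    case (Suc n)
    have "real (k + 1) * (\<Sum>m<Suc n. real m ^ k)
        = real (k + 1) * (\<Sum>m<n. real m ^ k) + real (k + 1) * real n ^ k"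
      by (simp add: algebra_simps)
    then show ?case
      unfolding Suc.IH Suc_times_power_eq_sum_gbinomial_deriv T_Suc
      by (simp only: distrib_left sum.distrib)
  qed
  then show ?thesis
    by (simp only: T_def mult_ac)
qed

theorem mainTheorem4:
  fixes k n :: nat
  assumes "n \<ge> 1"
  shows "poly (power_sum_poly k) (- real n) =
    (- 1) ^ (k + 1) / real (k + 1) *
      (\<Sum>j = 1..k + 1. (- 1) ^ j * fact j * real (Stirling (k + 1) j) *
        (\<Sum>i = 1..j. (- 1) ^ i / real (j + 1 - i) * real (n choose i)))"
  unfolding power_sum_poly_uminus sum_powers_eq_Stirling_double_sum [symmetric]
  by simp

end
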